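(* Let $X$ be a real vector space, $\Phi$ a set of elementary functions on $X$ with $0\in\Phi$, and $f,g:X\to(-\infty,+\infty]$ proper functions with $\operatorname{dom} f\cap\operatorname{dom} g\ne\emptyset$. Let $\mathcal{L}(x,\varphi)=f(x)+\varphi(x)-g_\Phi^*(\varphi)$ be the $\Phi$-Lagrangian and assume that $\kappa:=\inf_{x\in X}\sup_{\varphi\in\Phi}\mathcal{L}(x,\varphi)<+\infty$. Consider the following conditions: (1) $$0\in\bigcap_{\varepsilon>0}(\partial_\Phi^\varepsilon f+\partial_\Phi^\varepsilon g)(X);$$ (2) for every $\alpha<\inf_{x\in X}\sup_{\varphi\in\Phi}\mathcal{L}(x,\varphi)$ there exist $\bar\varphi,\tilde\varphi\in\Phi$, $\varphi_1\in\operatorname{supp}_\Phi\mathcal{L}(\cdot,\bar\varphi)$ and $\varphi_2\in\operatorname{supp}_\Phi\mathcal{L}(\cdot,\tilde\varphi)$ such that $\varphi_1$ and $\varphi_2$ have the intersection property on $X$ at the level $\alpha$. Then: (A) If $\Phi$ is convex, $\Phi=-\Phi$, and $$\inf_{x\in X}\{f(x)+g(x)\}=\inf_{x\in X}\{f(x)+g_\Phi^{**}(x)\}=\inf_{x\in X}\sup_{\varphi\in\Phi}\mathcal{L}(x,\varphi)=\kappa,$$ then (2) implies (1). (B) If $\Phi+\Phi\subset\Phi$, then (1) implies (2).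
   Context: A set of elementary functions $\Phi$ on $X$ is a set of real-valued functions $\varphi:X\to\mathbb{R}$ closed under addition of real constants. Operations on functions are pointwise; $-\Phi=\{-\varphi:\varphi\in\Phi\}$ and $\Phi+\Phi=\{\varphi+\psi:\varphi,\psi\in\Phi\}$. A function $h:X\to(-\infty,+\infty]$ is proper if $\operatorname{dom} h=\{x: h(x)<+\infty\}\ne\emptyset$. $\Phi$-conjugate: $g_\Phi^*(\varphi)=\sup_{x\in X}(\varphi(x)-g(x))$ for $\varphi\in\Phi$. $\Phi$-biconjugate: $g_\Phi^{**}(x)=\sup_{\varphi\in\Phi}(\varphi(x)-g_\Phi^*(\varphi))$ for $x\in X$. For $\varepsilon>0$ and $\bar x\in\operatorname{dom} h$, $\partial_\Phi^\varepsilon h(\bar x)$ is the set of $\varphi\in\Phi$ such that $h(x)-h(\bar x)\ge\varphi(x)-\varphi(\bar x)-\varepsilon$ for all $x\in X$; it is empty for $\bar x\notin\operatorname{dom} h$. $(\partial_\Phi^\varepsilon f+\partial_\Phi^\varepsilon g)(X)=\bigcup_{x\in X}\bigl(\partial_\Phi^\varepsilon f(x)+\partial_\Phi^\varepsilon g(x)\bigr)$. For $h:X\to[-\infty,+\infty]$, $\operatorname{supp}_\Phi(h)=\{\varphi\in\Phi:\varphi(x)\le h(x)\ \forall x\in X\}$. $\mathcal{L}$ takes values in $[-\infty,+\infty]$; where an expression $(+\infty)+(-\infty)$ occurs (only at points $x$ with $f(x)=+\infty$) it may be read as $+\infty$. Levels $\alpha$ are real numbers. Intersection property: functions $\varphi_1,\varphi_2:X\to\mathbb{R}$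 have the intersection property on $X$ at the level $\alpha\in\mathbb{R}$ if for every $t\in[0,1]$, either $[t\varphi_1+(1-t)\varphi_2<\alpha]\cap[\varphi_1<\alpha]=\emptyset$ or $[t\varphi_1+(1-t)\varphi_2<\alpha]\cap[\varphi_2<\alpha]=\emptyset$, where $[\varphi<\alpha]=\{x\in X:\varphi(x)<\alpha\}$.
   Formalization: In (A) the assumption κ > −∞ is added: if κ = −∞ then (2) holds vacuously, while (1) would force f+g to be bounded below, so (A) fails (e.g. X=ℝ, Φ affine functions, f(x)=x, g=0). *)

theory Defs
  imports "HOL-Analysis.Analysis" "HOL-Library.Function_Algebras"
begin

text \<open>
  The theory \<open>Function_Algebras\<close> provides the pointwise \<open>0\<close>, \<open>+\<close>, \<open>-\<close> on functions, and
  \<open>Set_Algebras\<close> the elementwise \<open>+\<close> on sets.  Pointwise scaling is added here so that the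
  library predicate \<open>convex\<close> applies to sets of functions.
\<close>

instantiation "fun" :: (type, real_vector) real_vector
begin

definition scaleR_fun :: "real \<Rightarrow> ('a \<Rightarrow> 'b) \<Rightarrow> 'a \<Rightarrow> 'b" where
  "scaleR_fun r \<phi> = (\<lambda>x. r *\<^sub>R \<phi> x)"

instance
  by standard (auto simp: scaleR_fun_def fun_eq_iff algebra_simps)

end

definition elementary_functions :: "('a \<Rightarrow> real) set \<Rightarrow> bool" where
  "elementary_functions \<Phi> \<longleftrightarrow> (\<forall>\<phi>\<in>\<Phi>. \<forall>c. (\<lambda>x. \<phi> x + c) \<in> \<Phi>)"

definition eff_dom :: "('a \<Rightarrow> ereal) \<Rightarrow> 'a set" where
  "eff_dom h = {x. h x < \<infinity>}"

text \<open>The first conjunct expresses that \<open>h\<close> takes its values in \<open>(-\<infinity>, +\<infinity>]\<close>.\<close>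

definition proper_fun :: "('a \<Rightarrow> ereal) \<Rightarrow> bool" where
  "proper_fun h \<longleftrightarrow> (\<forall>x. h x \<noteq> -\<infinity>) \<and> eff_dom h \<noteq> {}"

text \<open>
  The formula for the \<open>\<Phi>\<close>-conjugate at \<open>\<phi>\<close> does not mention \<open>\<Phi>\<close>; it is only used for
  \<open>\<phi> \<in> \<Phi>\<close>.
\<close>

definition Phi_conjugate :: "('a \<Rightarrow> ereal) \<Rightarrow> ('a \<Rightarrow> real) \<Rightarrow> ereal" where
  "Phi_conjugate g \<phi> = (SUP x. ereal (\<phi> x) - g x)"

definition Phi_biconjugate :: "('a \<Rightarrow> real) set \<Rightarrow> ('a \<Rightarrow> ereal) \<Rightarrow> 'a \<Rightarrow> ereal" where
  "Phi_biconjugate \<Phi> g x = (SUP \<phi>\<in>\<Phi>. ereal (\<phi> x) - Phi_conjugate g \<phi>)"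

text \<open>
  In type \<open>ereal\<close>, \<open>\<infinity> - \<infinity> = \<infinity>\<close>, so the Lagrangian is \<open>+\<infinity>\<close> wherever \<open>f\<close> is.
\<close>

definition Phi_Lagrangian ::
    "('a \<Rightarrow> ereal) \<Rightarrow> ('a \<Rightarrow> ereal) \<Rightarrow> 'a \<Rightarrow> ('a \<Rightarrow> real) \<Rightarrow> ereal" where
  "Phi_Lagrangian f g x \<phi> = f x + ereal (\<phi> x) - Phi_conjugate g \<phi>"

definition eps_subdiff ::
    "('a \<Rightarrow> real) set \<Rightarrow> real \<Rightarrow> ('a \<Rightarrow> ereal) \<Rightarrow> 'a \<Rightarrow> ('a \<Rightarrow> real) set" where
  "eps_subdiff \<Phi> \<epsilon> h y =
     {\<phi>\<in>\<Phi>. y \<in> eff_dom h \<and> (\<forall>x. h x - h y \<ge> ereal (\<phi> x - \<phi> y - \<epsilon>))}"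

definition Phi_supp :: "('a \<Rightarrow> real) set \<Rightarrow> ('a \<Rightarrow> ereal) \<Rightarrow> ('a \<Rightarrow> real) set" where
  "Phi_supp \<Phi> h = {\<phi>\<in>\<Phi>. \<forall>x. ereal (\<phi> x) \<le> h x}"

definition strict_sublevel :: "('a \<Rightarrow> real) \<Rightarrow> real \<Rightarrow> 'a set" where
  "strict_sublevel \<phi> \<alpha> = {x. \<phi> x < \<alpha>}"

definition intersection_property :: "('a \<Rightarrow> real) \<Rightarrow> ('a \<Rightarrow> real) \<Rightarrow> real \<Rightarrow> bool" where
  "intersection_property \<phi>1 \<phi>2 \<alpha> \<longleftrightarrow>
     (\<forall>t\<in>{0..1}.
        strict_sublevel (\<lambda>x. t * \<phi>1 x + (1 - t) * \<phi>2 x) \<alpha> \<inter> strict_sublevel \<phi>1 \<alpha> = {} \<or>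
        strict_sublevel (\<lambda>x. t * \<phi>1 x + (1 - t) * \<phi>2 x) \<alpha> \<inter> strict_sublevel \<phi>2 \<alpha> = {})"

end

theory Submission
  imports Defs
begin

text \<open>
  Unfolding the conjugate, \<open>\<alpha> \<le> \<L>(\<cdot>, \<phi>)\<close> on all of \<open>X\<close> means
  \<open>\<alpha> - \<phi> x + \<phi> y \<le> f x + g y\<close> for all \<open>x\<close> and \<open>y\<close>.  If moreover \<open>z\<close> is nearly optimal for
  \<open>f + g\<close> and \<open>\<alpha>\<close> is close to the optimal value, then putting \<open>y = z\<close> or \<open>x = z\<close> shows that \<open>-\<phi>\<close>
  and \<open>\<phi>\<close> are approximate subgradients of \<open>f\<close> and \<open>g\<close> at \<open>z\<close>, and conversely.  So (1) says that
  the dual values come arbitrarily close to \<open>inf (f + g)\<close>, which is at least \<open>\<kappa>\<close>.  In (A), the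
  intersection property and connectedness of \<open>[0, 1]\<close> give a convex combination of \<open>\<phi>\<^sub>1\<close> and
  \<open>\<phi>\<^sub>2\<close> which is \<open>\<ge> \<alpha>\<close>, and concavity of \<open>\<L>(x, \<cdot>)\<close> transfers this bound to the same combination
  of the dual variables.  In (B), the constant function \<open>\<alpha>\<close> serves as both \<open>\<phi>\<^sub>1\<close> and \<open>\<phi>\<^sub>2\<close>.
\<close>

text \<open>If every combination dipped below \<alpha> somewhere, each t in [0, 1] would have a dip
  inside \<open>[\<phi>1 < \<alpha>]\<close> or inside \<open>[\<phi>2 < \<alpha>]\<close>, and by
  the intersection property never inside both: a separation of the connected interval.\<close>

lemma intersection_property_imp_convex_combination_ge:
  assumes "intersection_property \<phi>1 \<phi>2 \<alpha>"
  obtains t where "t \<in> {0..1}" "\<And>x. \<alpha> \<le> t * \<phi>1 x + (1 - t) * \<phi>2 x"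
proof (rule ccontr)
  assume "\<not> thesis"
  with that have ex: "\<exists>x. t * \<phi>1 x + (1 - t) * \<phi>2 x < \<alpha>" if "t \<in> {0..1}" for t
    using \<open>t \<in> {0..1}\<close> by (meson not_le)
  define T where "T \<phi> = (\<Union>x\<in>strict_sublevel \<phi> \<alpha>. {t. t * \<phi>1 x + (1 - t) * \<phi>2 x < \<alpha>})" for \<phi>
  have op: "open (T \<phi>)" for \<phi>
    unfolding T_def by (intro open_UN ballI open_Collect_less continuous_intros)
  have disj: "T \<phi>1 \<inter> T \<phi>2 \<inter> {0..1} = {}"
  proof (rule equals0I)
    fix t assume "t \<in> T \<phi>1 \<inter> T \<phi>2 \<inter> {0..1}"
    then show False
      using assms unfolding intersection_property_def T_def strict_sublevel_def by blast
  qed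
  have cover: "{0..1} \<subseteq> T \<phi>1 \<union> T \<phi>2"
  proof
    fix t :: real assume t: "t \<in> {0..1}"
    then obtain x where x: "t * \<phi>1 x + (1 - t) * \<phi>2 x < \<alpha>" using ex by blast
    \<comment> \<open>Two values \<ge> \<alpha> would have a convex combination \<ge> \<alpha>;
      negation turns this into the upper bound form of \<open>convex_bound_le\<close>.\<close>
    have "\<phi>1 x < \<alpha> \<or> \<phi>2 x < \<alpha>"
      using x t convex_bound_le[of "-\<phi>1 x" "-\<alpha>" "-\<phi>2 x" t "1 - t"] by force
    then show "t \<in> T \<phi>1 \<union> T \<phi>2"
      using x by (auto simp: T_def strict_sublevel_def)
  qed
  have "1 \<in> T \<phi>1" "0 \<in> T \<phi>2"
    using ex[of 1] ex[of 0] by (auto simp: T_def strict_sublevel_def)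
  then show False
    using connectedD[OF connected_Icc op op disj cover] by (auto simp: disjoint_iff)
qed

text \<open>Replaces the supremum in the conjugate by inequalities on \<open>f x + g y\<close>, a
  sum in which \<infinity> never meets -\<infinity>. Where f is infinite both sides hold, thanks to
  the convention \<infinity> - \<infinity> = \<infinity>.\<close>

lemma le_Phi_Lagrangian_iff:
  assumes "proper_fun f" "proper_fun g"
  shows "ereal p \<le> Phi_Lagrangian f g x \<phi> \<longleftrightarrow> (\<forall>y. ereal (p - \<phi> x + \<phi> y) \<le> f x + g y)"
proof (cases "f x")
  case (real a)
  have "ereal p \<le> Phi_Lagrangian f g x \<phi> \<longleftrightarrow> Phi_conjugate g \<phi> \<le> ereal (a + \<phi> x - p)"
    unfolding Phi_Lagrangian_def real by (cases "Phi_conjugate g \<phi>") auto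
  also have "\<dots> \<longleftrightarrow> (\<forall>y. ereal (\<phi> y) - g y \<le> ereal (a + \<phi> x - p))"
    unfolding Phi_conjugate_def by (simp add: SUP_le_iff)
  also have "\<dots> \<longleftrightarrow> (\<forall>y. ereal (p - \<phi> x + \<phi> y) \<le> f x + g y)"
  proof (intro all_cong1)
    fix y
    have "g y \<noteq> -\<infinity>" using assms by (auto simp: proper_fun_def)
    then show "ereal (\<phi> y) - g y \<le> ereal (a + \<phi> x - p)
        \<longleftrightarrow> ereal (p - \<phi> x + \<phi> y) \<le> f x + g y"
      unfolding real by (cases "g y") auto
  qed
  finally show ?thesis .
next
  case MInf
  then show ?thesis using assms by (auto simp: proper_fun_def)
qed (simp add: Phi_Lagrangian_def)

text \<open>Weak duality: for y = x the two values of \<phi> in \<open>le_Phi_Lagrangian_iff\<close>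
  cancel.\<close>

lemma Phi_Lagrangian_le:
  assumes "proper_fun f" "proper_fun g"
  shows "Phi_Lagrangian f g x \<phi> \<le> f x + g x"
proof -
  have le: "ereal p \<le> f x + g x" if "ereal p \<le> Phi_Lagrangian f g x \<phi>" for p
    using that le_Phi_Lagrangian_iff[OF assms] by (metis diff_add_cancel)
  show ?thesis
  proof (cases "Phi_Lagrangian f g x \<phi>")
    case PInf
    with le have "f x + g x = \<infinity>" by (intro ereal_top) simp
    then show ?thesis by (metis ereal_less_eq(1))
  qed (use le in auto)
qed

text \<open>Concavity in the dual variable: for fixed x and y, the lower bound on
  \<open>f x + g y\<close> is affine in the pair (p, \<phi>).\<close>

lemma Phi_Lagrangian_convex_combination_ge:
  assumes "proper_fun f" "proper_fun g" "t \<in> {0..1}"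
    and "ereal p \<le> Phi_Lagrangian f g x \<phi>" "ereal q \<le> Phi_Lagrangian f g x \<psi>"
  shows "ereal (t * p + (1 - t) * q)
    \<le> Phi_Lagrangian f g x (t *\<^sub>R \<phi> + (1 - t) *\<^sub>R \<psi>)"
  unfolding le_Phi_Lagrangian_iff[OF assms(1,2)]
proof
  fix y
  have *: "ereal (p - \<phi> x + \<phi> y) \<le> f x + g y" "ereal (q - \<psi> x + \<psi> y) \<le> f x + g y"
    using assms by (simp_all add: le_Phi_Lagrangian_iff)
  \<comment> \<open>The maximum is a real intermediate bound, since \<open>f x + g y\<close> may be
    infinite.\<close>
  have "t * (p - \<phi> x + \<phi> y) + (1 - t) * (q - \<psi> x + \<psi> y)
      \<le> max (p - \<phi> x + \<phi> y) (q - \<psi> x + \<psi> y)"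
    using assms(3) by (intro convex_bound_le) auto
  also have "ereal \<dots> \<le> f x + g y"
    using * by (simp add: max_def)
  finally show "ereal (t * p + (1 - t) * q - (t *\<^sub>R \<phi> + (1 - t) *\<^sub>R \<psi>) x
      + (t *\<^sub>R \<phi> + (1 - t) *\<^sub>R \<psi>) y) \<le> f x + g y"
    by (simp add: scaleR_fun_def algebra_simps)
qed

lemma eps_subdiff_iff:
  assumes "h y = ereal a"
  shows "\<phi> \<in> eps_subdiff \<Phi> \<epsilon> h y \<longleftrightarrow>
    \<phi> \<in> \<Phi> \<and> (\<forall>x. ereal (a + \<phi> x - \<phi> y - \<epsilon>) \<le> h x)"
proof -
  have "ereal (\<phi> x - \<phi> y - \<epsilon>) \<le> h x - ereal a \<longleftrightarrow> ereal (a + \<phi> x - \<phi> y - \<epsilon>) \<le> h x" for x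
    by (cases "h x") auto
  then show ?thesis
    by (simp add: eps_subdiff_def eff_dom_def assms)
qed

lemma eps_subdiff_of_near_optimal:
  assumes "proper_fun f" "proper_fun g"
    and "\<phi> \<in> \<Phi>" "- \<phi> \<in> \<Phi>"
    and ge: "\<And>x. ereal \<alpha> \<le> Phi_Lagrangian f g x \<phi>"
    and near: "f z + g z \<le> ereal (\<alpha> + \<epsilon>)"
  shows "- \<phi> \<in> eps_subdiff \<Phi> \<epsilon> f z" "\<phi> \<in> eps_subdiff \<Phi> \<epsilon> g z"
proof -
  have nm: "f x \<noteq> -\<infinity>" "g x \<noteq> -\<infinity>" for x
    using assms by (auto simp: proper_fun_def)
  obtain a b where z: "f z = ereal a" "g z = ereal b"
    using near nm[of z] by (cases "f z"; cases "g z") auto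
  have *: "ereal (\<alpha> - \<phi> x + \<phi> y) \<le> f x + g y" for x y
    using ge le_Phi_Lagrangian_iff[OF assms(1,2)] by blast
  \<comment> \<open>With y = z the bound is \<alpha> - \<phi> x + \<phi> z - b \<le> f x, and
    near-optimality gives \<alpha> - b \<ge> a - \<epsilon>.\<close>
  have "ereal (a + (- \<phi>) x - (- \<phi>) z - \<epsilon>) \<le> f x" for x
    using *[of x z] near nm[of x] z by (cases "f x") auto
  then show "- \<phi> \<in> eps_subdiff \<Phi> \<epsilon> f z"
    using assms(4) eps_subdiff_iff[of f, OF z(1)] by blast
  have "ereal (b + \<phi> x - \<phi> z - \<epsilon>) \<le> g x" for x
    using *[of z x] near nm[of x] z by (cases "g x") auto
  then show "\<phi> \<in> eps_subdiff \<Phi> \<epsilon> g z"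
    using assms(3) eps_subdiff_iff[of g, OF z(2)] by blast
qed

text \<open>On adding the inequality for f at x to that for g at y, the values of \<phi> at z cancel
  and the two errors add up to 2 * \<epsilon>.\<close>

lemma Phi_Lagrangian_ge_of_eps_subdiff:
  assumes "proper_fun f" "proper_fun g"
    and sub: "- \<phi> \<in> eps_subdiff \<Phi> \<epsilon> f z" "\<phi> \<in> eps_subdiff \<Phi> \<epsilon> g z"
    and \<alpha>: "ereal (\<alpha> + 2 * \<epsilon>) \<le> f z + g z"
  shows "ereal \<alpha> \<le> Phi_Lagrangian f g x \<phi>"
  unfolding le_Phi_Lagrangian_iff[OF assms(1,2)]
proof
  fix y
  have nm: "f x \<noteq> -\<infinity>" "g x \<noteq> -\<infinity>" for x
    using assms by (auto simp: proper_fun_def)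
  obtain a b where z: "f z = ereal a" "g z = ereal b"
    using sub nm[of z] by (cases "f z"; cases "g z") (auto simp: eps_subdiff_def eff_dom_def)
  have "ereal (\<alpha> - \<phi> x + \<phi> y) \<le> ereal (a + (- \<phi>) x - (- \<phi>) z - \<epsilon>) + ereal (b + \<phi> y - \<phi> z - \<epsilon>)"
    using \<alpha> z by simp
  also have "\<dots> \<le> f x + g y"
    using sub eps_subdiff_iff[of f, OF z(1)] eps_subdiff_iff[of g, OF z(2)] by (intro add_mono) blast+
  finally show "ereal (\<alpha> - \<phi> x + \<phi> y) \<le> f x + g y" .
qed

theorem theorem6p7:
  fixes \<Phi> :: "('a::real_vector \<Rightarrow> real) set"
    and f g :: "'a \<Rightarrow> ereal"
    and \<kappa> :: ereal
  assumes "elementary_functions \<Phi>"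
    and "0 \<in> \<Phi>"
    and "proper_fun f"
    and "proper_fun g"
    and "eff_dom f \<inter> eff_dom g \<noteq> {}"
    and "\<kappa> = (INF x. SUP \<phi>\<in>\<Phi>. Phi_Lagrangian f g x \<phi>)"
    and "\<kappa> < \<infinity>"
  shows
    "(convex \<Phi> \<longrightarrow> \<Phi> = uminus ` \<Phi> \<longrightarrow>
      (INF x. f x + g x) = (INF x. f x + Phi_biconjugate \<Phi> g x) \<longrightarrow>
      (INF x. f x + Phi_biconjugate \<Phi> g x) = (INF x. SUP \<phi>\<in>\<Phi>. Phi_Lagrangian f g x \<phi>) \<longrightarrow>
      -\<infinity> < \<kappa> \<longrightarrow>
      (\<forall>\<alpha>::real. ereal \<alpha> < (INF x. SUP \<phi>\<in>\<Phi>. Phi_Lagrangian f g x \<phi>) \<longrightarrow>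
        (\<exists>\<phi>'\<in>\<Phi>. \<exists>\<phi>''\<in>\<Phi>.
          \<exists>\<phi>1\<in>Phi_supp \<Phi> (\<lambda>x. Phi_Lagrangian f g x \<phi>').
          \<exists>\<phi>2\<in>Phi_supp \<Phi> (\<lambda>x. Phi_Lagrangian f g x \<phi>'').
            intersection_property \<phi>1 \<phi>2 \<alpha>)) \<longrightarrow>
      0 \<in> (\<Inter>\<epsilon>\<in>{0<..}. \<Union>x. eps_subdiff \<Phi> \<epsilon> f x + eps_subdiff \<Phi> \<epsilon> g x))
     \<and>
     (\<Phi> + \<Phi> \<subseteq> \<Phi> \<longrightarrow>
      0 \<in> (\<Inter>\<epsilon>\<in>{0<..}. \<Union>x. eps_subdiff \<Phi> \<epsilon> f x + eps_subdiff \<Phi> \<epsilon> g x) \<longrightarrow>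
      (\<forall>\<alpha>::real. ereal \<alpha> < (INF x. SUP \<phi>\<in>\<Phi>. Phi_Lagrangian f g x \<phi>) \<longrightarrow>
        (\<exists>\<phi>'\<in>\<Phi>. \<exists>\<phi>''\<in>\<Phi>.
          \<exists>\<phi>1\<in>Phi_supp \<Phi> (\<lambda>x. Phi_Lagrangian f g x \<phi>').
          \<exists>\<phi>2\<in>Phi_supp \<Phi> (\<lambda>x. Phi_Lagrangian f g x \<phi>'').
            intersection_property \<phi>1 \<phi>2 \<alpha>)))"
proof -
  have dual: "\<exists>\<phi>\<in>\<Phi>. \<forall>x. ereal \<alpha> \<le> Phi_Lagrangian f g x \<phi>"
    if "convex \<Phi>" "\<phi>' \<in> \<Phi>" "\<phi>'' \<in> \<Phi>"
      "\<phi>1 \<in> Phi_supp \<Phi> (\<lambda>x. Phi_Lagrangian f g x \<phi>')"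
      "\<phi>2 \<in> Phi_supp \<Phi> (\<lambda>x. Phi_Lagrangian f g x \<phi>'')"
      and ip: "intersection_property \<phi>1 \<phi>2 \<alpha>" for \<alpha> \<phi>' \<phi>'' \<phi>1 \<phi>2
  proof -
    obtain t where t: "t \<in> {0..1}" "\<And>x. \<alpha> \<le> t * \<phi>1 x + (1 - t) * \<phi>2 x"
      using intersection_property_imp_convex_combination_ge[OF ip] by blast
    have "ereal (t * \<phi>1 x + (1 - t) * \<phi>2 x)
        \<le> Phi_Lagrangian f g x (t *\<^sub>R \<phi>' + (1 - t) *\<^sub>R \<phi>'')" for x
      using that(4,5) assms(3,4) t(1)
      by (intro Phi_Lagrangian_convex_combination_ge) (auto simp: Phi_supp_def)
    then have "ereal \<alpha> \<le> Phi_Lagrangian f g x (t *\<^sub>R \<phi>' + (1 - t) *\<^sub>R \<phi>'')" for x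
      using t(2)[of x] by (meson ereal_less_eq(3) order_trans)
    moreover have "t *\<^sub>R \<phi>' + (1 - t) *\<^sub>R \<phi>'' \<in> \<Phi>"
      using that(1-3) t(1) by (intro convexD) auto
    ultimately show ?thesis by blast
  qed
  have A: "\<exists>z. 0 \<in> eps_subdiff \<Phi> \<epsilon> f z + eps_subdiff \<Phi> \<epsilon> g z"
    if "\<Phi> = uminus ` \<Phi>" "(INF x. f x + g x) = \<kappa>" and fin: "-\<infinity> < \<kappa>" and "\<epsilon> > 0"
      and ex: "\<And>\<alpha>. ereal \<alpha> < \<kappa> \<Longrightarrow> \<exists>\<phi>\<in>\<Phi>. \<forall>x. ereal \<alpha> \<le> Phi_Lagrangian f g x \<phi>" for \<epsilon>
  proof -
    \<comment> \<open>For \<kappa> = -\<infinity> condition (2) is vacuous, while (1) would bound f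
      + g from below; finiteness excludes this case.\<close>
    obtain k where k: "\<kappa> = ereal k"
      using fin assms(7) by (cases \<kappa>) auto
    \<comment> \<open>Half of \<epsilon> is spent above k on the primal point z and half below k on
      the dual variable \<phi>.\<close>
    have "(INF x. f x + g x) < ereal (k + \<epsilon> / 2)"
      using that(2) \<open>\<epsilon> > 0\<close> k by simp
    then obtain z where z: "f z + g z < ereal (k + \<epsilon> / 2)"
      by (auto simp: INF_less_iff)
    obtain \<phi> where \<phi>: "\<phi> \<in> \<Phi>" "\<And>x. ereal (k - \<epsilon> / 2) \<le> Phi_Lagrangian f g x \<phi>"
      using ex[of "k - \<epsilon> / 2"] \<open>\<epsilon> > 0\<close> k by auto
    have "- \<phi> \<in> \<Phi>" using \<phi>(1) that(1) by blast
    have "f z + g z \<le> ereal (k - \<epsilon> / 2 + \<epsilon>)" using z by (simp add: field_simps)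
    from eps_subdiff_of_near_optimal[OF assms(3,4) \<phi>(1) \<open>- \<phi> \<in> \<Phi>\<close> \<phi>(2) this]
    have "- \<phi> + \<phi> \<in> eps_subdiff \<Phi> \<epsilon> f z + eps_subdiff \<Phi> \<epsilon> g z"
      by (rule set_plus_intro)
    then show ?thesis by auto
  qed
  have B: "\<exists>\<phi>'\<in>\<Phi>. \<exists>\<phi>''\<in>\<Phi>.
          \<exists>\<phi>1\<in>Phi_supp \<Phi> (\<lambda>x. Phi_Lagrangian f g x \<phi>').
          \<exists>\<phi>2\<in>Phi_supp \<Phi> (\<lambda>x. Phi_Lagrangian f g x \<phi>'').
            intersection_property \<phi>1 \<phi>2 \<alpha>"
    if zero: "0 \<in> (\<Inter>\<epsilon>\<in>{0<..}. \<Union>x. eps_subdiff \<Phi> \<epsilon> f x + eps_subdiff \<Phi> \<epsilon> g x)"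
      and lt: "ereal \<alpha> < \<kappa>" for \<alpha>
  proof -
    obtain \<beta> where \<beta>: "ereal \<alpha> < ereal \<beta>" "ereal \<beta> < \<kappa>"
      using ereal_dense2[OF lt] by blast
    \<comment> \<open>The gap between \<alpha> and \<beta> pays for one error \<epsilon> from f and
      one from g.\<close>
    define \<epsilon> where "\<epsilon> = (\<beta> - \<alpha>) / 2"
    have "\<epsilon> > 0" using \<beta>(1) by (simp add: \<epsilon>_def)
    then obtain z where "0 \<in> eps_subdiff \<Phi> \<epsilon> f z + eps_subdiff \<Phi> \<epsilon> g z"
      using zero by blast
    then obtain \<psi> \<phi> where "\<psi> + \<phi> = 0" "\<psi> \<in> eps_subdiff \<Phi> \<epsilon> f z"
        and \<phi>: "\<phi> \<in> eps_subdiff \<Phi> \<epsilon> g z"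
      by (metis set_plus_elim)
    then have \<psi>: "- \<phi> \<in> eps_subdiff \<Phi> \<epsilon> f z"
      by (metis add_eq_0_iff2)
    \<comment> \<open>Weak duality at z puts \<open>f z + g z\<close> above \<kappa>, hence above
      \<beta>.\<close>
    have "ereal \<beta> \<le> (SUP \<phi>\<in>\<Phi>. Phi_Lagrangian f g z \<phi>)"
      using \<beta>(2) unfolding assms(6) by (meson INF_lower UNIV_I less_imp_le order_trans)
    also have "\<dots> \<le> f z + g z"
      by (intro SUP_least Phi_Lagrangian_le assms)
    finally have "ereal (\<alpha> + 2 * \<epsilon>) \<le> f z + g z" by (simp add: \<epsilon>_def field_simps)
    then have "ereal \<alpha> \<le> Phi_Lagrangian f g x \<phi>" for x
      using Phi_Lagrangian_ge_of_eps_subdiff[OF assms(3,4) \<psi> \<phi>] by blast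
    moreover have "(\<lambda>_. \<alpha>) \<in> \<Phi>"
      using assms(1,2) unfolding elementary_functions_def
      by (metis (no_types, lifting) add_0 ext zero_fun_apply)
    ultimately have "(\<lambda>_. \<alpha>) \<in> Phi_supp \<Phi> (\<lambda>x. Phi_Lagrangian f g x \<phi>)"
      by (simp add: Phi_supp_def)
    moreover have "\<phi> \<in> \<Phi>" using \<phi> by (simp add: eps_subdiff_def)
    \<comment> \<open>The strict sublevel set of the constant \<alpha> at level \<alpha> is
      empty.\<close>
    moreover have "intersection_property (\<lambda>_. \<alpha>) (\<lambda>_. \<alpha>) \<alpha>"
      by (simp add: intersection_property_def strict_sublevel_def)
    ultimately show ?thesis by blast
  qed
  show ?thesis
    unfolding assms(6)[symmetric]
  proof (intro conjI impI allI INT_I)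
    fix \<epsilon> :: real
    assume "convex \<Phi>" "\<Phi> = uminus ` \<Phi>" "-\<infinity> < \<kappa>" "\<epsilon> \<in> {0<..}"
      "(INF x. f x + g x) = (INF x. f x + Phi_biconjugate \<Phi> g x)"
      "(INF x. f x + Phi_biconjugate \<Phi> g x) = \<kappa>"
      and ex: "\<forall>\<alpha>. ereal \<alpha> < \<kappa> \<longrightarrow>
        (\<exists>\<phi>'\<in>\<Phi>. \<exists>\<phi>''\<in>\<Phi>.
          \<exists>\<phi>1\<in>Phi_supp \<Phi> (\<lambda>x. Phi_Lagrangian f g x \<phi>').
          \<exists>\<phi>2\<in>Phi_supp \<Phi> (\<lambda>x. Phi_Lagrangian f g x \<phi>'').
            intersection_property \<phi>1 \<phi>2 \<alpha>)"
    moreover have "\<exists>\<phi>\<in>\<Phi>. \<forall>x. ereal \<alpha> \<le> Phi_Lagrangian f g x \<phi>" if "ereal \<alpha> < \<kappa>" for \<alpha>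
      using ex that dual[OF \<open>convex \<Phi>\<close>] by meson
    ultimately show "0 \<in> (\<Union>x. eps_subdiff \<Phi> \<epsilon> f x + eps_subdiff \<Phi> \<epsilon> g x)"
      using A[of \<epsilon>] by auto
  qed (rule B)
qed

end
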